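(* By returning all items $x\in\mathcal U$ for which $\widehat{v^W_x}\ge M\cdot W\cdot\theta$, the algorithm WFAST solves the $(W,\theta,\epsilon,M)$-Weighted Heavy Hitters problem. That is, after processing any $(\mathcal U,M)$-weighted stream, with $\widehat{v^W_x}$ the value returned by WinQuery$(x)$, the set $H=\{x\in\mathcal U\mid \widehat{v^W_x}\ge MW\theta\}$ satisfies, for every $x\in\mathcal U$, $$\bigl(v^W_x>W\cdot M\cdot\theta\implies x\in H\bigr)\ \wedge\ \bigl(v^W_x<W\cdot M\cdot(\theta-\epsilon)\implies x\notin H\bigr).$$
   Context: Streams. Given a set $\mathcal U$ (the universe of ids) and a positive integer $M$, a $(\mathcal U,M)$-weighted stream of length $N$ is a sequence $\langle p_1,\dots,p_N\rangle$ with $p_i=(d_i,w_i)\in\mathcal U\times\{1,\dots,M\}$ (id and weight). For a positive integer window size $W$, the window volume of $x$ is $v^W_x=\sum_{i\in\{N-W+1,\dots,N\},\,d_i=x}w_i$, the total weight of packets with id $x$ among the last $W$ packets. $\theta$ is a heavy hitters threshold parameter. Algorithm FAST$(M,\delta,\phi)$ (with $\delta>0$, $\phi\ge 0$). Let $s=\lfloor M\phi/2+1\rfloor$ and $\mathfrak C=\lceil (1+\phi)/\delta\rceil$. State: a set $C\subseteq\mathcal U$ and non-negative integers $c_x,r_x$ for $x\in\mathcal U$; initially $C=\emptyset$, $c_x=r_x=0$. Add$(x,w)$: if $x\in C$ or $|C|<\mathfrak C$, set $c_x\gets c_x+\lfloor (r_x+w)/s\rfloor$, $r_x\gets (r_x+w)\bmod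 s$ (both using the old $r_x$), $C\gets C\cup\{x\}$; otherwise choose an arbitrary $m\in\arg\min_{y\in C}c_y$, set $c_x\gets c_m+\lfloor (s-1+w)/s\rfloor$, $r_x\gets (s-1+w)\bmod s$, $C\gets (C\setminus\{m\})\cup\{x\}$. Query$(x)$: if $x\in C$ or $|C|<\mathfrak C$, return $r_x+s c_x$; otherwise return $s-1+s\min_{y\in C}c_y$. A flush resets the instance to its initial state. Algorithm WFAST, with window size $W$, maximal weight $M$, accuracy $\epsilon>0$ and parameter $\phi$. Let $k=\lceil 4/\epsilon\rceil$; it is assumed that $W/k$ is an integer. The stream is partitioned into frames of $W$ packets, each split into $k$ blocks of $W/k$ packets. State: a FAST instance $y=$ FAST$(M,1/k,\phi)$; an offset $o$, initially $0$; a (FIFO) queue $b$ of $k+1$ (FIFO) queues of ids, initially all empty, whose head is the queue of the current (newest) block and whose tail is the queue of the oldest block; and a table $B$ of integer counts indexed by ids, initially empty. Add$(x,w)$: 1. $o\gets (o+1)\bmod W$. 2. If $o=0$ (new frame), flush $y$. 3. If $o\bmod (W/k)=0$ (new block), remove the oldest (tail) queue from $b$ and append a new empty queue as the head. 4. If the tail queue of $b$ is not empty, pop its oldest id $z$, decrease $B[z]$ by $1$, and remove $z$ from $B$ if $B[z]=0$. 5. Let $\pi=\left\lfloor \frac{y.\mathrm{Query}(x)}{MW/k}\right\rfloor$, then call $y.\mathrm{Add}(x,w)$. 6. If now $\left\lfloor \frac{y.\mathrm{Query}(x)}{MW/k}\right\rfloor>\pi$ ($x$ overflows), push $x$ onto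 the head queue of $b$, and increase $B[x]$ by $1$ (setting $B[x]=1$ if $x$ was not in $B$). WinQuery$(x)$: if $x$ is in $B$, return $\frac{MW}{k}(B[x]+2)+\left(y.\mathrm{Query}(x)\bmod \frac{MW}{k}\right)$; otherwise return $2\frac{MW}{k}+y.\mathrm{Query}(x)$. Processing the stream means calling Add$(d_i,w_i)$ for $i=1,\dots,N$ in order. *)

theory Defs
  imports Complex_Main
begin

type_synonym 'a stream = "('a \<times> nat) list"

definition weighted_stream :: "'a set \<Rightarrow> nat \<Rightarrow> 'a stream \<Rightarrow> bool" where
  "weighted_stream U M p \<longleftrightarrow> set p \<subseteq> U \<times> {1..M}"

text \<open>Packets are indexed from 0 here, so the last \<open>W\<close> packets have the indices from
  \<open>length p - W\<close> on. The subtraction truncates: if the stream has fewer than \<open>W\<close> packets, the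
  window is the whole stream.\<close>

definition window_volume :: "nat \<Rightarrow> 'a stream \<Rightarrow> 'a \<Rightarrow> nat" where
  "window_volume W p x =
     (\<Sum>i | i \<in> {length p - W..<length p} \<and> fst (p ! i) = x. snd (p ! i))"

definition weighted_heavy_hitters ::
  "'a set \<Rightarrow> nat \<Rightarrow> real \<Rightarrow> real \<Rightarrow> nat \<Rightarrow> 'a stream \<Rightarrow> 'a set \<Rightarrow> bool" where
  "weighted_heavy_hitters U W \<theta> \<epsilon> M p H \<longleftrightarrow>
     (\<forall>x\<in>U. (real (window_volume W p x) > real W * real M * \<theta> \<longrightarrow> x \<in> H) \<and>
            (real (window_volume W p x) < real W * real M * (\<theta> - \<epsilon>) \<longrightarrow> x \<notin> H))"


record 'a fast =
  ids :: "'a set"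
  cnt :: "'a \<Rightarrow> nat"
  rmd :: "'a \<Rightarrow> nat"

definition fast_init :: "'a fast" where
  "fast_init = \<lparr>ids = {}, cnt = (\<lambda>_. 0), rmd = (\<lambda>_. 0)\<rparr>"

definition fast_step :: "nat \<Rightarrow> real \<Rightarrow> nat" where
  "fast_step M \<phi> = nat \<lfloor>real M * \<phi> / 2 + 1\<rfloor>"

definition fast_capacity :: "real \<Rightarrow> real \<Rightarrow> nat" where
  "fast_capacity \<delta> \<phi> = nat \<lceil>(1 + \<phi>) / \<delta>\<rceil>"

text \<open>\<open>fast_add M \<delta> \<phi> y x w y'\<close>: adding \<open>(x, w)\<close> in state \<open>y\<close> may lead to state \<open>y'\<close>. It is a
  relation because the evicted id \<open>m\<close> is an arbitrary minimiser, which may be chosen differently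
  each time.\<close>

inductive fast_add ::
  "nat \<Rightarrow> real \<Rightarrow> real \<Rightarrow> 'a fast \<Rightarrow> 'a \<Rightarrow> nat \<Rightarrow> 'a fast \<Rightarrow> bool"
  for M :: nat and \<delta> \<phi> :: real and y :: "'a fast" and x :: 'a and w :: nat where
  keep:
  "fast_add M \<delta> \<phi> y x w
     \<lparr>ids = ids y \<union> {x},
      cnt = (cnt y)(x := cnt y x + (rmd y x + w) div s),
      rmd = (rmd y)(x := (rmd y x + w) mod s)\<rparr>"
  if "s = fast_step M \<phi>" and "x \<in> ids y \<or> card (ids y) < fast_capacity \<delta> \<phi>"
| evict:
  "fast_add M \<delta> \<phi> y x w
     \<lparr>ids = (ids y - {m}) \<union> {x},
      cnt = (cnt y)(x := cnt y m + (s - 1 + w) div s),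
      rmd = (rmd y)(x := (s - 1 + w) mod s)\<rparr>"
  if "s = fast_step M \<phi>" and "\<not> (x \<in> ids y \<or> card (ids y) < fast_capacity \<delta> \<phi>)"
    and "is_arg_min (cnt y) (\<lambda>z. z \<in> ids y) m"

definition fast_query :: "nat \<Rightarrow> real \<Rightarrow> real \<Rightarrow> 'a fast \<Rightarrow> 'a \<Rightarrow> nat" where
  "fast_query M \<delta> \<phi> y x =
     (let s = fast_step M \<phi> in
      if x \<in> ids y \<or> card (ids y) < fast_capacity \<delta> \<phi>
      then rmd y x + s * cnt y x
      else s - 1 + s * Min (cnt y ` ids y))"


text \<open>The queue of queues lists the blocks from the newest (head) to the oldest (tail); each
  block lists its ids from the first pushed to the last pushed.\<close>

record 'a wfast =
  inst :: "'a fast"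
  offset :: nat
  blocks :: "'a list list"
  table :: "'a \<rightharpoonup> int"

definition wfast_k :: "real \<Rightarrow> nat" where
  "wfast_k \<epsilon> = nat \<lceil>4 / \<epsilon>\<rceil>"

text \<open>The number \<open>M W / k\<close>; the division is exact when \<open>k dvd W\<close>.\<close>

definition wfast_unit :: "nat \<Rightarrow> nat \<Rightarrow> real \<Rightarrow> nat" where
  "wfast_unit W M \<epsilon> = M * W div wfast_k \<epsilon>"

definition wfast_init :: "real \<Rightarrow> 'a wfast" where
  "wfast_init \<epsilon> =
     \<lparr>inst = fast_init, offset = 0, blocks = replicate (wfast_k \<epsilon> + 1) [], table = Map.empty\<rparr>"

abbreviation inst_query :: "nat \<Rightarrow> real \<Rightarrow> real \<Rightarrow> 'a fast \<Rightarrow> 'a \<Rightarrow> nat" where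
  "inst_query M \<epsilon> \<phi> \<equiv> fast_query M (1 / real (wfast_k \<epsilon>)) \<phi>"

abbreviation inst_add ::
  "nat \<Rightarrow> real \<Rightarrow> real \<Rightarrow> 'a fast \<Rightarrow> 'a \<Rightarrow> nat \<Rightarrow> 'a fast \<Rightarrow> bool" where
  "inst_add M \<epsilon> \<phi> \<equiv> fast_add M (1 / real (wfast_k \<epsilon>)) \<phi>"

definition advance_offset :: "nat \<Rightarrow> 'a wfast \<Rightarrow> 'a wfast" where
  "advance_offset W st = st\<lparr>offset := (offset st + 1) mod W\<rparr>"

definition start_frame :: "'a wfast \<Rightarrow> 'a wfast" where
  "start_frame st = (if offset st = 0 then st\<lparr>inst := fast_init\<rparr> else st)"

definition start_block :: "nat \<Rightarrow> real \<Rightarrow> 'a wfast \<Rightarrow> 'a wfast" where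
  "start_block W \<epsilon> st =
     (if offset st mod (W div wfast_k \<epsilon>) = 0
      then st\<lparr>blocks := [] # butlast (blocks st)\<rparr> else st)"

definition expire :: "'a wfast \<Rightarrow> 'a wfast" where
  "expire st =
     (case last (blocks st) of
        [] \<Rightarrow> st
      | z # zs \<Rightarrow>
          (let n = the (table st z) - 1 in
           st\<lparr>blocks := butlast (blocks st) @ [zs],
              table := (table st)(z := (if n = 0 then None else Some n))\<rparr>))"

definition push_overflow :: "'a \<Rightarrow> 'a wfast \<Rightarrow> 'a wfast" where
  "push_overflow x st =
     st\<lparr>blocks := (hd (blocks st) @ [x]) # tl (blocks st),
        table := (table st)(x \<mapsto> (case table st x of None \<Rightarrow> 1 | Some n \<Rightarrow> n + 1))\<rparr>"

inductive wfast_add ::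
  "nat \<Rightarrow> nat \<Rightarrow> real \<Rightarrow> real \<Rightarrow> 'a wfast \<Rightarrow> 'a \<Rightarrow> nat \<Rightarrow> 'a wfast \<Rightarrow> bool"
  for W M :: nat and \<epsilon> \<phi> :: real and st :: "'a wfast" and x :: 'a and w :: nat where
  "wfast_add W M \<epsilon> \<phi> st x w
     (if inst_query M \<epsilon> \<phi> y x div wfast_unit W M \<epsilon> > \<pi>
      then push_overflow x (st'\<lparr>inst := y\<rparr>) else st'\<lparr>inst := y\<rparr>)"
  if "st' = expire (start_block W \<epsilon> (start_frame (advance_offset W st)))"
    and "\<pi> = inst_query M \<epsilon> \<phi> (inst st') x div wfast_unit W M \<epsilon>"
    and "inst_add M \<epsilon> \<phi> (inst st') x w y"

text \<open>\<open>wfast_run W M \<epsilon> \<phi> p st\<close>: processing the stream \<open>p\<close> may end in state \<open>st\<close>.\<close>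

inductive wfast_run ::
  "nat \<Rightarrow> nat \<Rightarrow> real \<Rightarrow> real \<Rightarrow> 'a stream \<Rightarrow> 'a wfast \<Rightarrow> bool"
  for W M :: nat and \<epsilon> \<phi> :: real where
  empty: "wfast_run W M \<epsilon> \<phi> [] (wfast_init \<epsilon>)"
| snoc: "wfast_run W M \<epsilon> \<phi> (p @ [(x, w)]) st'"
  if "wfast_run W M \<epsilon> \<phi> p st" and "wfast_add W M \<epsilon> \<phi> st x w st'"

definition win_query :: "nat \<Rightarrow> nat \<Rightarrow> real \<Rightarrow> real \<Rightarrow> 'a wfast \<Rightarrow> 'a \<Rightarrow> int" where
  "win_query W M \<epsilon> \<phi> st x =
     (let T = wfast_unit W M \<epsilon>; q = inst_query M \<epsilon> \<phi> (inst st) x in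
      case table st x of
        Some n \<Rightarrow> int T * (n + 2) + int (q mod T)
      | None \<Rightarrow> 2 * int T + int q)"

definition reported ::
  "'a set \<Rightarrow> nat \<Rightarrow> nat \<Rightarrow> real \<Rightarrow> real \<Rightarrow> real \<Rightarrow> 'a wfast \<Rightarrow> 'a set" where
  "reported U W M \<epsilon> \<phi> \<theta> st =
     {x \<in> U. real_of_int (win_query W M \<epsilon> \<phi> st x) \<ge> real M * real W * \<theta>}"


text \<open>The relations never get stuck, so every stream has at least one run.\<close>

lemma fast_add_total:
  assumes "fast_capacity \<delta> \<phi> > 0"
  shows "\<exists>y'. fast_add M \<delta> \<phi> y x w y'"
proof (cases "x \<in> ids y \<or> card (ids y) < fast_capacity \<delta> \<phi>")
  case True
  from fast_add.keep[OF refl this] show ?thesis ..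
next
  case False
  then have "card (ids y) > 0" using assms by linarith
  then have "finite (ids y)" "ids y \<noteq> {}" by (auto simp: card_gt_0_iff)
  then obtain m where "is_arg_min (cnt y) (\<lambda>z. z \<in> ids y) m"
    using ex_is_arg_min_if_finite[of "ids y" "cnt y"] by blast
  from fast_add.evict[OF refl False this] show ?thesis ..
qed

lemma wfast_run_total:
  assumes "\<epsilon> > 0" and "\<phi> \<ge> 0"
  shows "\<exists>st. wfast_run W M \<epsilon> \<phi> p st"
proof (induction p rule: rev_induct)
  case Nil
  show ?case using wfast_run.empty ..
next
  case (snoc a p)
  have "wfast_k \<epsilon> > 0" using assms by (simp add: wfast_k_def)
  then have cap: "fast_capacity (1 / real (wfast_k \<epsilon>)) \<phi> > 0"
    using assms by (simp add: fast_capacity_def)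
  obtain st where st: "wfast_run W M \<epsilon> \<phi> p st" using snoc by blast
  obtain y where "inst_add M \<epsilon> \<phi>
      (inst (expire (start_block W \<epsilon> (start_frame (advance_offset W st))))) (fst a) (snd a) y"
    using fast_add_total[OF cap] ..
  from wfast_run.snoc[OF st wfast_add.intros[OF refl refl this]] show ?case
    unfolding prod.collapse ..
qed

end

theory Submission
  imports Defs
begin

text \<open>Write \<open>T = M W / k\<close>. Within a frame the FAST estimate of an id grows by exactly \<open>w\<close> when a
  packet of that id with weight \<open>w\<close> arrives. At other times it can only grow while the id is
  untracked, and then the estimate is at most \<open>T\<close>, even below \<open>T\<close> before the last packet of the
  frame. So the only multiple of \<open>T\<close> that is ever crossed without a recorded overflow is \<open>T\<close>
  itself, at the last packet of a frame; hence over any segment of a frame the volume of the id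
  differs from \<open>T\<close> times the number of its overflows by less than \<open>T\<close>.

  The window consists of the current frame prefix and a suffix of the previous frame. The table
  counts the overflows of an id in the window, except that removing one queue element per packet
  may be too early for some overflows in the oldest block. At most one of them belongs to the id:
  the rest of that block has volume less than \<open>T\<close>. The summand \<open>2 T\<close> of the query
  pays for this missing overflow and for the rounding in the previous frame.\<close>

section \<open>FAST: invariant, bound and change of the estimates under one packet\<close>

lemma fast_step_pos: "fast_step M \<phi> > 0" if "\<phi> \<ge> 0"
proof -
  have "1 \<le> \<lfloor>real M * \<phi> / 2 + 1\<rfloor>" using that by (simp add: le_floor_iff)
  then show ?thesis unfolding fast_step_def by linarith
qed

lemma fast_step_le: "2 * (real (fast_step M \<phi>) - 1) \<le> real M * \<phi>" if "\<phi> \<ge> 0"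
proof -
  have "0 \<le> \<lfloor>real M * \<phi> / 2 + 1\<rfloor>" using that by (simp add: le_floor_iff)
  then have "real (fast_step M \<phi>) = of_int \<lfloor>real M * \<phi> / 2 + 1\<rfloor>"
    by (simp add: fast_step_def)
  also have "\<dots> \<le> real M * \<phi> / 2 + 1" by (rule of_int_floor_le)
  finally show ?thesis by simp
qed

lemma card_exchange:
  assumes "finite A" and "m \<in> A" and "x \<notin> A"
  shows "card (insert x (A - {m})) = card A"
proof -
  have "card (insert x (A - {m})) = Suc (card (A - {m}))"
    using assms by (intro card_insert_disjoint) auto
  also have "\<dots> = card A" using assms by (intro card_Suc_Diff1)
  finally show ?thesis .
qed

text \<open>\<open>N\<close> bounds the number of packets since the last flush. With
  \<open>s = fast_step M \<phi>\<close>, the sum of the tracked estimates grows per packet by at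
  most \<open>M\<close>, plus \<open>s - 1\<close> of rounding at an eviction. The number of tracked
  ids never falls, so stale counters of evicted ids exist only at full capacity.\<close>

definition fast_inv :: "nat \<Rightarrow> real \<Rightarrow> real \<Rightarrow> nat \<Rightarrow> 'a fast \<Rightarrow> bool" where
  "fast_inv M \<delta> \<phi> N y \<longleftrightarrow>
     finite (ids y) \<and> card (ids y) \<le> N \<and> (\<forall>x. rmd y x < fast_step M \<phi>) \<and>
     (card (ids y) < fast_capacity \<delta> \<phi> \<longrightarrow> (\<forall>x. x \<notin> ids y \<longrightarrow> cnt y x = 0 \<and> rmd y x = 0)) \<and>
     (\<Sum>x\<in>ids y. rmd y x + fast_step M \<phi> * cnt y x) \<le> N * (M + (fast_step M \<phi> - 1))"

lemma fast_inv_init: "\<phi> \<ge> 0 \<Longrightarrow> fast_inv M \<delta> \<phi> 0 fast_init"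
  by (simp add: fast_inv_def fast_init_def fast_step_pos)

lemma fast_inv_mono: "fast_inv M \<delta> \<phi> N y \<Longrightarrow> N \<le> N' \<Longrightarrow> fast_inv M \<delta> \<phi> N' y"
  unfolding fast_inv_def by (meson le_trans mult_le_mono1)

lemma fast_inv_add:
  assumes inv: "fast_inv M \<delta> \<phi> N y" and add: "fast_add M \<delta> \<phi> y x w y'"
    and "w \<le> M" and "\<phi> \<ge> 0"
  shows "fast_inv M \<delta> \<phi> (Suc N) y'"
  using add
proof cases
  case (keep s)
  let ?e = "\<lambda>y x. rmd y x + s * cnt y x"
  have s: "s > 0" using fast_step_pos[OF \<open>\<phi> \<ge> 0\<close>] keep(2) by simp
  have fin: "finite (ids y)" and card: "card (ids y) \<le> N" and rmd: "\<And>x. rmd y x < s"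
    and zero: "\<And>z. card (ids y) < fast_capacity \<delta> \<phi> \<Longrightarrow> z \<notin> ids y \<Longrightarrow> cnt y z = 0 \<and> rmd y z = 0"
    and sum: "sum (?e y) (ids y) \<le> N * (M + (s - 1))"
    using inv keep(2) by (auto simp: fast_inv_def)
  have new: "?e y' x = ?e y x + w"
    using keep(1) mult_div_mod_eq[of s "rmd y x + w"] by (simp add: distrib_left)
  have old: "?e y' z = ?e y z" if "z \<noteq> x" for z using that keep(1) by simp
  have "sum (?e y') (ids y') = sum (?e y) (ids y) + w"
  proof -
    have "sum (?e y') (ids y') = ?e y' x + sum (?e y') (ids y - {x})"
      using keep(1) fin sum.insert_remove[of "ids y" "?e y'" x] by simp
    also have "sum (?e y') (ids y - {x}) = sum (?e y) (ids y - {x})"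
      by (rule sum.cong) (auto simp: old)
    also have "?e y' x + \<dots> = sum (?e y) (ids y) + w"
    proof (cases "x \<in> ids y")
      case True
      then show ?thesis using fin new by (simp add: sum.remove[of _ x])
    next
      case False
      \<comment> \<open>A newly tracked id starts from estimate 0: \<open>keep\<close> accepts it
        only below capacity, where no stale counters exist.\<close>
      with zero[of x] keep(3) have "?e y x = 0" by auto
      with False show ?thesis using new by simp
    qed
    finally show ?thesis .
  qed
  moreover have "card (ids y') \<le> Suc N"
    using keep(1) fin card by (simp add: card_insert_if)
  moreover have "\<forall>z. z \<notin> ids y' \<longrightarrow> cnt y' z = 0 \<and> rmd y' z = 0"
    if "card (ids y') < fast_capacity \<delta> \<phi>"
  proof -
    have "card (ids y) < fast_capacity \<delta> \<phi>"
      using that keep(1) fin by (simp add: card_insert_if split: if_splits)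
    then show ?thesis using keep(1) zero by auto
  qed
  ultimately show ?thesis
    using keep(1) fin rmd s sum \<open>w \<le> M\<close> unfolding fast_inv_def keep(2)[symmetric] by simp
next
  case (evict s m)
  let ?e = "\<lambda>y x. rmd y x + s * cnt y x"
  have s: "s > 0" using fast_step_pos[OF \<open>\<phi> \<ge> 0\<close>] evict(2) by simp
  have fin: "finite (ids y)" and card: "card (ids y) \<le> N" and rmd: "\<And>x. rmd y x < s"
    and sum: "sum (?e y) (ids y) \<le> N * (M + (s - 1))"
    using inv evict(2) by (auto simp: fast_inv_def)
  have m: "m \<in> ids y" and x: "x \<notin> ids y" using evict(3,4) by (auto simp: is_arg_min_def)
  then have "x \<noteq> m" by auto
  have new: "?e y' x = s * cnt y m + (s - 1 + w)"
    using evict(1) mult_div_mod_eq[of s "s - 1 + w"] by (simp add: distrib_left)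
  have cardeq: "card (ids y') = card (ids y)"
    using evict(1) card_exchange[OF fin m x] by simp
  have "sum (?e y') (ids y') = ?e y' x + sum (?e y') (ids y - {m})"
    using evict(1) fin x by simp
  also have "sum (?e y') (ids y - {m}) = sum (?e y) (ids y - {m})"
    by (rule sum.cong) (use x evict(1) in auto)
  \<comment> \<open>The removed summand of \<open>m\<close> is at least \<open>s * cnt y m\<close>,
    which leaves \<open>s - 1 + w\<close> of the new one.\<close>
  also have "?e y' x + \<dots> \<le> sum (?e y) (ids y) + (s - 1 + w)"
    using fin m new by (simp add: sum.remove[of _ m])
  finally have "sum (?e y') (ids y') \<le> Suc N * (M + (s - 1))"
    using sum \<open>w \<le> M\<close> by simp
  then show ?thesis
    using cardeq evict(1,3) fin rmd s card unfolding fast_inv_def evict(2)[symmetric] by auto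
qed

text \<open>All \<open>K\<close> tracked counters are at least the minimum \<open>c\<close>, so the
  sum invariant bounds \<open>K * (s * c)\<close>; the extra \<open>s - 1\<close> of the query costs
  \<open>K * (s - 1)\<close>, at most \<open>N * (s - 1)\<close>. The total
  \<open>N * (M + 2 * (s - 1))\<close> is at most \<open>(1 + \<phi>) * N * M\<close>, and full
  capacity gives \<open>K \<ge> (1 + \<phi>) / \<delta>\<close>.\<close>

lemma fast_query_untracked_le:
  assumes inv: "fast_inv M \<delta> \<phi> N y" and "\<delta> > 0" and \<phi>: "\<phi> \<ge> 0"
    and z: "\<not> (z \<in> ids y \<or> card (ids y) < fast_capacity \<delta> \<phi>)"
  shows "real (fast_query M \<delta> \<phi> y z) \<le> \<delta> * real N * real M"
proof -
  define s where "s = fast_step M \<phi>"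
  define c where "c = Min (cnt y ` ids y)"
  define K where "K = card (ids y)"
  have s: "s > 0" using fast_step_pos[OF \<phi>] s_def by simp
  have fin: "finite (ids y)" and card: "K \<le> N"
    and sum: "(\<Sum>x\<in>ids y. rmd y x + s * cnt y x) \<le> N * (M + (s - 1))"
    using inv by (auto simp: fast_inv_def s_def K_def)
  have "K * (s * c) = (\<Sum>x\<in>ids y. s * c)" by (simp add: K_def)
  also have "\<dots> \<le> (\<Sum>x\<in>ids y. rmd y x + s * cnt y x)"
    by (rule sum_mono) (use fin in \<open>auto simp: c_def intro!: trans_le_add2 mult_le_mono2\<close>)
  finally have "K * (s * c) \<le> N * (M + (s - 1))" using sum by simp
  then have "K * (s - 1 + s * c) \<le> N * (s - 1) + N * (M + (s - 1))"
    using card by (simp add: distrib_left add_mono)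
  then have "real (K * (s - 1 + s * c)) \<le> real (N * (s - 1) + N * (M + (s - 1)))"
    by (rule of_nat_mono)
  also have "\<dots> = real N * (real M + 2 * (real s - 1))"
  proof -
    have "real (s - 1) = real s - 1" using s by (simp add: of_nat_diff)
    then show ?thesis unfolding of_nat_add of_nat_mult by (simp only:) (simp add: algebra_simps)
  qed
  also have "\<dots> \<le> real N * (real M + real M * \<phi>)"
    using fast_step_le[OF \<phi>, of M] by (intro mult_left_mono) (auto simp: s_def)
  also have "\<dots> = (1 + \<phi>) * (real N * real M)" by (simp add: algebra_simps)
  finally have *: "real K * real (s - 1 + s * c) \<le> (1 + \<phi>) * (real N * real M)" by simp
  have "(1 + \<phi>) / \<delta> \<le> real (fast_capacity \<delta> \<phi>)"
    unfolding fast_capacity_def by (rule real_nat_ceiling_ge)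
  also have "\<dots> \<le> real K" using z by (simp add: K_def)
  finally have "(1 + \<phi>) / \<delta> * real (s - 1 + s * c) \<le> real K * real (s - 1 + s * c)"
    by (rule mult_right_mono) simp
  also note *
  finally have "(1 + \<phi>) * real (s - 1 + s * c) \<le> (1 + \<phi>) * (\<delta> * real N * real M)"
    using \<open>\<delta> > 0\<close> by (simp add: field_simps)
  then have "real (s - 1 + s * c) \<le> \<delta> * real N * real M"
    using \<phi> by (subst (asm) mult_le_cancel_left_pos) auto
  moreover have "fast_query M \<delta> \<phi> y z = s - 1 + s * c"
    using z by (simp add: fast_query_def Let_def s_def c_def)
  ultimately show ?thesis by simp
qed

text \<open>An untracked id is queried with exactly the value to which an eviction adds
  \<open>w\<close>, so the arrival of an id causes no jump of its own estimate.\<close>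

lemma fast_query_add_same:
  assumes "fast_add M \<delta> \<phi> y x w y'" and fin: "finite (ids y)"
  shows "fast_query M \<delta> \<phi> y' x = fast_query M \<delta> \<phi> y x + w"
  using assms(1)
proof cases
  case (keep s)
  then show ?thesis using mult_div_mod_eq[of s "rmd y x + w"]
    by (simp add: fast_query_def Let_def distrib_left)
next
  case (evict s m)
  then have "Min (cnt y ` ids y) = cnt y m"
    unfolding is_arg_min_linorder
    by (intro Min_eqI) (auto simp: fin)
  then show ?thesis using evict mult_div_mod_eq[of s "s - 1 + w"]
    by (simp add: fast_query_def Let_def distrib_left)
qed

text \<open>Below capacity a fresh id could lower the minimum. At capacity, counters only rise, or a
  minimal one gives way to one at least as large.\<close>

lemma fast_add_Min_mono:
  assumes "fast_add M \<delta> \<phi> y x w y'" and fin: "finite (ids y)" and "ids y \<noteq> {}"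
    and full: "\<not> card (ids y) < fast_capacity \<delta> \<phi>"
  shows "Min (cnt y ` ids y) \<le> Min (cnt y' ` ids y')"
  using assms(1)
proof cases
  case (keep s)
  have "Min (cnt y ` ids y) \<le> cnt y' u" if "u \<in> ids y'" for u
  proof -
    have "u \<in> ids y" using that keep full by auto
    then have "Min (cnt y ` ids y) \<le> cnt y u" using fin by simp
    also have "\<dots> \<le> cnt y' u" using keep(1) by simp
    finally show ?thesis .
  qed
  moreover have "finite (ids y')" "ids y' \<noteq> {}" using fin keep(1) by auto
  ultimately show ?thesis by auto
next
  case (evict s m)
  have "Min (cnt y ` ids y) \<le> cnt y' u" if "u \<in> ids y'" for u
  proof (cases "u = x")
    case True
    have "Min (cnt y ` ids y) \<le> cnt y m" using fin evict(4) by (simp add: is_arg_min_def)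
    also have "\<dots> \<le> cnt y' u" using True evict(1) by simp
    finally show ?thesis .
  next
    case False
    then have "u \<in> ids y" using that evict(1) by auto
    then have "Min (cnt y ` ids y) \<le> cnt y u" using fin by simp
    then show ?thesis using False evict(1) by simp
  qed
  moreover have "finite (ids y')" "ids y' \<noteq> {}" using fin evict(1) by auto
  ultimately show ?thesis by auto
qed

text \<open>If \<open>z\<close> is tracked or capacity is free afterwards, the same held before and
  the counters of \<open>z\<close> are untouched. Otherwise \<open>z\<close> was just evicted as a
  minimiser, or had estimate 0 below capacity, or was read off the minimum, which cannot
  fall.\<close>

lemma fast_query_add_other:
  assumes inv: "fast_inv M \<delta> \<phi> N y" and add: "fast_add M \<delta> \<phi> y x w y'" and "z \<noteq> x"
    and "\<phi> \<ge> 0" and cap: "fast_capacity \<delta> \<phi> > 0"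
  shows "fast_query M \<delta> \<phi> y' z = fast_query M \<delta> \<phi> y z \<or>
    fast_query M \<delta> \<phi> y z \<le> fast_query M \<delta> \<phi> y' z \<and>
      \<not> (z \<in> ids y' \<or> card (ids y') < fast_capacity \<delta> \<phi>)"
proof (cases "z \<in> ids y' \<or> card (ids y') < fast_capacity \<delta> \<phi>")
  case True
  have fin: "finite (ids y)" using inv by (simp add: fast_inv_def)
  have "z \<in> ids y \<or> card (ids y) < fast_capacity \<delta> \<phi>"
    using add
  proof cases
    case keep
    then show ?thesis using True \<open>z \<noteq> x\<close> fin by (auto simp: card_insert_if split: if_splits)
  next
    case (evict s m)
    then have "m \<in> ids y" and "x \<notin> ids y" by (auto simp: is_arg_min_def)
    then have "card (ids y') = card (ids y)"
      using card_exchange[OF fin] evict(1) by simp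
    then show ?thesis using True evict \<open>z \<noteq> x\<close> by auto
  qed
  moreover have "cnt y' z = cnt y z \<and> rmd y' z = rmd y z"
    using add by cases (use \<open>z \<noteq> x\<close> in auto)
  ultimately show ?thesis using True by (simp add: fast_query_def Let_def)
next
  case untracked: False
  define s where "s = fast_step M \<phi>"
  have s: "s > 0" using fast_step_pos[OF \<open>\<phi> \<ge> 0\<close>] s_def by simp
  have fin: "finite (ids y)" and rmd: "rmd y z < s"
    and zero: "card (ids y) < fast_capacity \<delta> \<phi> \<Longrightarrow> z \<notin> ids y \<Longrightarrow> cnt y z = 0 \<and> rmd y z = 0"
    using inv by (auto simp: fast_inv_def s_def)
  have q': "fast_query M \<delta> \<phi> y' z = s - 1 + s * Min (cnt y' ` ids y')"
    using untracked by (simp add: fast_query_def Let_def s_def)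
  have "fast_query M \<delta> \<phi> y z \<le> fast_query M \<delta> \<phi> y' z"
  proof (cases "z \<in> ids y")
    case True
    have full: "\<not> card (ids y) < fast_capacity \<delta> \<phi>" and min: "cnt y z = Min (cnt y ` ids y)"
    proof -
      from add have "\<not> card (ids y) < fast_capacity \<delta> \<phi> \<and> cnt y z = Min (cnt y ` ids y)"
      proof cases
        case keep
        then show ?thesis using True untracked by auto
      next
        case (evict s m)
        then have "z = m" using True untracked by auto
        with evict(3,4) show ?thesis unfolding is_arg_min_linorder
          by (auto intro!: Min_eqI[symmetric] simp: fin)
      qed
      then show "\<not> card (ids y) < fast_capacity \<delta> \<phi>" "cnt y z = Min (cnt y ` ids y)"
        by auto
    qed
    have "cnt y z \<le> Min (cnt y' ` ids y')"
      using fast_add_Min_mono[OF add fin _ full] True min by auto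
    \<comment> \<open>The remainder of the evicted id is at most \<open>s - 1\<close>, the remainder
      that a query assigns to untracked ids.\<close>
    then have "rmd y z + s * cnt y z \<le> s - 1 + s * Min (cnt y' ` ids y')"
      using rmd by (intro add_mono mult_le_mono2) auto
    then show ?thesis unfolding q' using True by (simp add: fast_query_def Let_def s_def)
  next
    case False
    show ?thesis
    proof (cases "card (ids y) < fast_capacity \<delta> \<phi>")
      case True
      then show ?thesis using zero False by (simp add: fast_query_def Let_def)
    next
      case full: False
      then have "ids y \<noteq> {}" using cap by auto
      then have "Min (cnt y ` ids y) \<le> Min (cnt y' ` ids y')"
        using fast_add_Min_mono[OF add fin _ full] by simp
      then show ?thesis unfolding q' using False full by (simp add: fast_query_def Let_def s_def)
    qed
  qed
  then show ?thesis using untracked by simp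
qed


section \<open>Overflows and volume of one id within one frame\<close>

text \<open>Because \<open>d \<le> T\<close>, at most one multiple of \<open>T\<close> is crossed;
  the overflow flag is the carry of the addition modulo \<open>T\<close>.\<close>

lemma overflow_carry:
  fixes r d T :: nat
  assumes "T > 0" and "d \<le> T"
  shows "T * of_bool (r div T < (r + d) div T) + (r + d) mod T = r mod T + d"
proof -
  have eq: "r + d = (r mod T + d) + T * (r div T)" by simp
  have div: "(r + d) div T = r div T + (r mod T + d) div T"
    by (subst eq, subst div_mult_self2) (use assms in auto)
  have mod: "(r + d) mod T = (r mod T + d) mod T"
    by (simp add: mod_add_left_eq)
  show ?thesis
  proof (cases "r mod T + d < T")
    case True
    then show ?thesis using div mod by simp
  next
    case False
    moreover have "r mod T < T" using assms by simp
    ultimately have "r mod T + d - T < T" using assms by linarith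
    then have "(r mod T + d) div T = 1" "(r mod T + d) mod T = r mod T + d - T"
      using False assms by (simp_all add: le_div_geq le_mod_geq)
    then show ?thesis using div mod False by simp
  qed
qed

text \<open>One id in the first \<open>L\<close> packets of a frame: \<open>R t\<close> is its
  estimate after \<open>t\<close> packets, \<open>g\<close> its arriving weight, \<open>ov\<close>
  its recorded overflows. In the second alternative of \<open>step\<close> another id arrives and
  the estimate may drift upwards, reaching \<open>T\<close> only at packet \<open>W\<close>.\<close>

locale overflow_frame =
  fixes W L T :: nat and R g :: "nat \<Rightarrow> nat" and ov :: "nat \<Rightarrow> bool"
  assumes T: "T > 0" and R0: "R 0 = 0" and L: "L \<le> W"
    and step: "t < L \<Longrightarrow>
      R (Suc t) = R t + g t \<and> g t \<le> T \<and> (ov t \<longleftrightarrow> R t div T < R (Suc t) div T) \<or>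
      \<not> ov t \<and> g t = 0 \<and> R t \<le> R (Suc t) \<and> R (Suc t) \<le> T \<and> (Suc t < W \<longrightarrow> R (Suc t) < T)"
begin

abbreviation count :: "nat \<Rightarrow> nat \<Rightarrow> nat" where
  "count a b \<equiv> \<Sum>t=a..<b. of_bool (ov t)"

abbreviation vol :: "nat \<Rightarrow> nat \<Rightarrow> nat" where
  "vol a b \<equiv> \<Sum>t=a..<b. g t"

lemma step_cases [consumes 1, case_names arrival jump]:
  assumes "t < L"
  obtains "R (Suc t) = R t + g t" and
      "T * of_bool (ov t) + R (Suc t) mod T = R t mod T + g t" and
      "R (Suc t) div T = R t div T + of_bool (ov t)"
  | "\<not> ov t" and "g t = 0" and "R t \<le> R (Suc t)" and "R (Suc t) \<le> T" and
      "Suc t < W \<Longrightarrow> R (Suc t) < T"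
proof -
  {
    assume *: "R (Suc t) = R t + g t" "g t \<le> T" "ov t \<longleftrightarrow> R t div T < R (Suc t) div T"
    then have carry: "T * of_bool (ov t) + R (Suc t) mod T = R t mod T + g t"
      using overflow_carry[OF T *(2), of "R t"] by simp
    have "T * (R (Suc t) div T) + R (Suc t) mod T = T * (R t div T) + R t mod T + g t"
      using *(1) by simp
    with carry have "T * (R (Suc t) div T) = T * (R t div T + of_bool (ov t))"
      unfolding distrib_left by linarith
    then have "R (Suc t) div T = R t div T + of_bool (ov t)" using T by simp
    with * carry have thesis using that(1) by blast
  }
  then show thesis using step[OF assms] that(2) by blast
qed

text \<open>Each overflow raises the quotient by one and nothing lowers it; in particular
  \<open>R b < T\<close> means that no overflow has occurred yet.\<close>

lemma count_le_div: "a \<le> b \<Longrightarrow> b \<le> L \<Longrightarrow> count a b \<le> R b div T"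
proof (induction b rule: dec_induct)
  case (step b)
  then have "b < L" by simp
  then show ?case
  proof (cases rule: step_cases)
    case arrival
    then show ?thesis using step by simp
  next
    case jump
    then have "R b div T \<le> R (Suc b) div T" by (simp add: div_le_mono)
    then show ?thesis using step jump by simp
  qed
qed simp

text \<open>At an arrival the carry identity changes both sides equally. A drift from below
  \<open>T\<close> precedes any overflow, so only the remainder is compared with \<open>T\<close>; a
  drift from \<open>T\<close> on changes nothing. The slack \<open>T\<close> pays for the unknown
  remainder at \<open>a\<close>.\<close>

lemma count_upper:
  "a \<le> b \<Longrightarrow> b \<le> L \<Longrightarrow> T * count a b + R b mod T < vol a b + T"
proof (induction b rule: dec_induct)
  case base
  show ?case using T by simp
next
  case (step b)
  then have IH: "T * count a b + R b mod T < vol a b + T" and b: "b < L" by simp_all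
  from b show ?case
  proof (cases rule: step_cases)
    case arrival
    then show ?thesis using IH step(1) by (simp add: distrib_left)
  next
    case jump
    show ?thesis
    proof (cases "R b < T")
      case True
      then have "count a b = 0" using count_le_div[of a b] b step(1) by simp
      moreover have "R (Suc b) mod T < T" using T by simp
      ultimately show ?thesis using jump step(1) by (simp add: trans_less_add2)
    next
      case False
      then have "R (Suc b) = R b" using jump by simp
      then show ?thesis using IH jump step(1) by simp
    qed
  qed
qed

text \<open>A drift that stays below \<open>T\<close> cannot reduce the remainder. Only one that
  lands on \<open>T\<close>, at the last packet of the frame, resets it; the second alternative
  records that loss.\<close>

lemma vol_upper:
  "a \<le> b \<Longrightarrow> b \<le> L \<Longrightarrow>
    vol a b \<le> T * count a b + R b mod T \<or> b = W \<and> vol a b < T * count a b + T"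
proof (induction b rule: dec_induct)
  case (step b)
  \<comment> \<open>The exceptional alternative cannot hold at \<open>b\<close>, because
    \<open>b < L\<close> and \<open>L \<le> W\<close>.\<close>
  then have IH: "vol a b \<le> T * count a b + R b mod T" and b: "b < L" using L by auto
  from b show ?case
  proof (cases rule: step_cases)
    case arrival
    then show ?thesis using IH step(1) by (simp add: distrib_left)
  next
    case jump
    show ?thesis
    proof (cases "Suc b < W")
      case True
      then have "R b mod T \<le> R (Suc b) mod T" using jump by simp
      then show ?thesis using IH jump step(1) by simp
    next
      case False
      have "R b mod T < T" using T by simp
      then have "vol a b < T * count a b + T" using IH by linarith
      then show ?thesis using False b L jump step(1) by simp
    qed
  qed
qed simp

lemma vol_less: "a \<le> b \<Longrightarrow> b \<le> L \<Longrightarrow> vol a b < T * count a b + T"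
  using vol_upper[of a b] mod_less_divisor[OF T, of "R b"] by linarith

lemma div_le_count: "t \<le> L \<Longrightarrow> R t div T \<le> count 0 t \<or> t = W \<and> R t \<le> T"
proof (induction t)
  case (Suc t)
  then have IH: "R t div T \<le> count 0 t" and t: "t < L" using L by auto
  from t show ?case
  proof (cases rule: step_cases)
    case arrival
    then show ?thesis using IH by simp
  next
    case jump
    then show ?thesis using t L by (cases "Suc t < W") auto
  qed
qed (simp add: R0)

text \<open>Needed for ids without a table entry. The value \<open>T\<close> itself is possible only
  at the end of the frame.\<close>

lemma le_of_count_eq_0:
  assumes "t \<le> L" and "count 0 t = 0"
  shows "R t \<le> T"
  using div_le_count[OF assms(1)] assms(2) T by (auto simp: div_eq_0_iff)

end

section \<open>The table as a function of the queues\<close>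

text \<open>The list is reversed so that the oldest block comes first, as in the lemmas on the
  queues.\<close>

definition table_of :: "'a list list \<Rightarrow> 'a \<rightharpoonup> int" where
  "table_of bs z =
     (let c = count_list (concat (rev bs)) z in if c = 0 then None else Some (int c))"

text \<open>With the oldest queue first, expiry is \<open>tl\<close> of the first list, and
  \<open>tl [] = []\<close> covers the case of nothing to pop.\<close>

lemma expire_rev:
  assumes "rev (blocks st) = r # rs" and "table st = table_of (blocks st)"
  shows "rev (blocks (expire st)) = tl r # rs"
    and "table (expire st) = table_of (blocks (expire st))"
proof -
  have bs: "blocks st = rev rs @ [r]" using assms(1) by (simp add: rev_swap)
  have "rev (blocks (expire st)) = tl r # rs \<and> table (expire st) = table_of (blocks (expire st))"
  proof (cases r)
    case Nil
    then show ?thesis using bs assms by (simp add: expire_def)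
  next
    case (Cons z zs)
    then show ?thesis using bs assms(2)
      by (auto simp: expire_def Let_def table_of_def fun_eq_iff)
  qed
  then show "rev (blocks (expire st)) = tl r # rs"
    and "table (expire st) = table_of (blocks (expire st))" by auto
qed

lemma push_overflow_rev:
  assumes "rev (blocks st) = qs @ [h]" and "table st = table_of (blocks st)"
  shows "rev (blocks (push_overflow x st)) = qs @ [h @ [x]]"
    and "table (push_overflow x st) = table_of (blocks (push_overflow x st))"
proof -
  have "blocks st = h # rev qs" using assms(1) by (simp add: rev_swap)
  then show "rev (blocks (push_overflow x st)) = qs @ [h @ [x]]"
    and "table (push_overflow x st) = table_of (blocks (push_overflow x st))"
    using assms(2) by (auto simp: push_overflow_def table_of_def fun_eq_iff Let_def)
qed

lemma expire_simps [simp]: "inst (expire st) = inst st" "offset (expire st) = offset st"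
  by (auto simp: expire_def Let_def split: list.split)

lemma push_overflow_simps [simp]:
  "inst (push_overflow x st) = inst st" "offset (push_overflow x st) = offset st"
  by (auto simp: push_overflow_def)

text \<open>Used with \<open>xs\<close> the pushes of the first \<open>m\<close> packets of a block:
  removing one element per packet removes all of these and possibly later ones.\<close>

lemma count_list_drop_append:
  assumes "length xs \<le> m"
  shows "count_list (drop m (xs @ ys)) x \<le> count_list ys x"
proof -
  let ?m = "m - length xs"
  have "count_list (drop ?m ys) x \<le> count_list (take ?m ys @ drop ?m ys) x"
    unfolding count_list_append by simp
  then show ?thesis using assms by simp
qed

section \<open>A run as a timed sequence of states\<close>

text \<open>Fixing the states of one run turns the arbitrary evictions into a function of time, so
  that different times can be compared.\<close>

lemma wfast_run_states:
  assumes "wfast_run W M \<epsilon> \<phi> p st"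
  shows "\<exists>S. S 0 = wfast_init \<epsilon> \<and> S (length p) = st \<and>
    (\<forall>i<length p. wfast_add W M \<epsilon> \<phi> (S i) (fst (p ! i)) (snd (p ! i)) (S (Suc i)))"
  using assms
proof induction
  case empty
  show ?case by auto
next
  case (snoc p st x w st')
  then obtain S where S: "S 0 = wfast_init \<epsilon>" "S (length p) = st"
    "\<And>i. i < length p \<Longrightarrow> wfast_add W M \<epsilon> \<phi> (S i) (fst (p ! i)) (snd (p ! i)) (S (Suc i))"
    by blast
  define S' where "S' = S(Suc (length p) := st')"
  have "S' 0 = wfast_init \<epsilon>" "S' (length (p @ [(x, w)])) = st'"
    using S(1) by (simp_all add: S'_def)
  moreover have "wfast_add W M \<epsilon> \<phi>
      (S' i) (fst ((p @ [(x, w)]) ! i)) (snd ((p @ [(x, w)]) ! i)) (S' (Suc i))"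
    if "i < length (p @ [(x, w)])" for i
    using that S snoc.hyps(2) by (cases "i = length p") (auto simp: S'_def nth_append)
  ultimately show ?case by blast
qed

text \<open>The \<open>i\<close>-th packet, counted from 1, gets the time \<open>W + i\<close>. So the window and all blocks
  that WFAST remembers consist of times that are natural numbers, and time \<open>W\<close> belongs to the
  initial state.\<close>

locale wfast_execution =
  fixes W M k n :: nat and \<epsilon> \<phi> :: real and p :: "'a stream" and S :: "nat \<Rightarrow> 'a wfast"
  assumes M: "M > 0" and W: "W > 0" and eps: "\<epsilon> > 0" and phi: "\<phi> \<ge> 0"
    and k_def: "k = wfast_k \<epsilon>" and W_eq: "W = k * n"
    and weights: "i < length p \<Longrightarrow> snd (p ! i) \<le> M"
    and S0: "S 0 = wfast_init \<epsilon>"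
    and S_Suc: "i < length p \<Longrightarrow>
      wfast_add W M \<epsilon> \<phi> (S i) (fst (p ! i)) (snd (p ! i)) (S (Suc i))"
begin

definition T :: nat where "T = M * n"
definition now :: nat where "now = W + length p"

lemma k_ge: "4 / \<epsilon> \<le> real k"
  unfolding k_def wfast_k_def by (rule real_nat_ceiling_ge)

lemma k_pos: "k > 0"
  using k_ge eps by (cases k) (auto simp: field_simps)

lemma n_pos: "n > 0"
  using W W_eq by (cases n) auto

lemma T_pos: "T > 0"
  using M n_pos by (simp add: T_def)

lemma unit_eq: "wfast_unit W M \<epsilon> = T"
proof -
  have "M * W = k * T" by (simp add: W_eq T_def)
  then show ?thesis using k_pos by (simp add: wfast_unit_def k_def[symmetric])
qed

text \<open>The 4 in the choice of \<open>k\<close> matches the at most \<open>4 * T\<close> by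
  which the query exceeds the window volume.\<close>

lemma four_T_le: "4 * real T \<le> real W * real M * \<epsilon>"
proof -
  have "4 \<le> \<epsilon> * real k" using k_ge eps by (simp add: field_simps)
  then have "4 * real T \<le> \<epsilon> * real k * real T" by (intro mult_right_mono) auto
  then show ?thesis by (simp add: T_def W_eq mult_ac)
qed

lemma capacity_pos: "fast_capacity (1 / real k) \<phi> > 0"
  using k_pos phi by (simp add: fast_capacity_def)

abbreviation query :: "'a fast \<Rightarrow> 'a \<Rightarrow> nat" where
  "query \<equiv> inst_query M \<epsilon> \<phi>"

lemma query_init [simp]: "query fast_init x = 0"
  using capacity_pos by (simp add: fast_query_def fast_init_def k_def)

text \<open>Truncated subtraction gives the initial state to the times before \<open>W\<close> as
  well.\<close>

definition state :: "nat \<Rightarrow> 'a wfast" where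
  "state t = S (t - W)"

definition packet :: "nat \<Rightarrow> 'a \<times> nat" where
  "packet t = p ! (t - Suc W)"

definition live :: "nat \<Rightarrow> bool" where
  "live t \<longleftrightarrow> W < t \<and> t \<le> now"

text \<open>The instance that the packet at time \<open>t\<close> meets: the offset at time
  \<open>t\<close> is \<open>t mod W\<close>, so flushes happen at the multiples of
  \<open>W\<close>.\<close>

definition pre_inst :: "nat \<Rightarrow> 'a fast" where
  "pre_inst t = (if W dvd t then fast_init else inst (state (t - 1)))"

definition pre :: "nat \<Rightarrow> 'a \<Rightarrow> nat" where
  "pre t = query (pre_inst t)"

definition post :: "nat \<Rightarrow> 'a \<Rightarrow> nat" where
  "post t = query (inst (state t))"

definition arrived :: "'a \<Rightarrow> nat \<Rightarrow> nat" where
  "arrived x t = (if live t \<and> fst (packet t) = x then snd (packet t) else 0)"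

definition overflow :: "nat \<Rightarrow> bool" where
  "overflow t \<longleftrightarrow> live t \<and> pre t (fst (packet t)) div T < post t (fst (packet t)) div T"

definition overflow_of :: "'a \<Rightarrow> nat \<Rightarrow> bool" where
  "overflow_of x t \<longleftrightarrow> overflow t \<and> fst (packet t) = x"

definition pushed :: "nat \<Rightarrow> nat \<Rightarrow> 'a list" where
  "pushed a b = map (fst \<circ> packet) (filter overflow [a..<b])"

text \<open>The offset is advanced before the packet is handled, so a block starts with the packet
  at a multiple of \<open>n\<close>. Time \<open>W\<close> has no packet, hence the block starting
  there is one packet short.\<close>

definition block :: "nat \<Rightarrow> 'a list" where
  "block i = pushed (i * n) (Suc i * n)"

definition middle :: "nat \<Rightarrow> 'a wfast" where
  "middle t = expire (start_block W \<epsilon> (start_frame (advance_offset W (state (t - 1)))))"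

lemma state_W: "state W = wfast_init \<epsilon>"
  by (simp add: state_def S0)

lemma live_add: "live t \<Longrightarrow>
  wfast_add W M \<epsilon> \<phi> (state (t - 1)) (fst (packet t)) (snd (packet t)) (state t)"
proof -
  assume "live t"
  then have "t - Suc W < length p" "Suc (t - Suc W) = t - W"
    by (auto simp: live_def now_def)
  then show ?thesis using S_Suc[of "t - Suc W"] by (simp add: state_def packet_def)
qed

lemma arrived_le: "arrived x t \<le> M"
  using weights[of "t - Suc W"] by (auto simp: arrived_def live_def now_def packet_def)

lemma middle_simps [simp]:
  "offset (middle t) = (offset (state (t - 1)) + 1) mod W"
  "inst (middle t) = (if (offset (state (t - 1)) + 1) mod W = 0 then fast_init else inst (state (t - 1)))"
  by (auto simp: middle_def start_block_def start_frame_def advance_offset_def)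

lemma state_eq:
  assumes "live t"
  obtains y where "inst_add M \<epsilon> \<phi> (inst (middle t)) (fst (packet t)) (snd (packet t)) y"
    and "state t = (if query y (fst (packet t)) div T > query (inst (middle t)) (fst (packet t)) div T
      then push_overflow (fst (packet t)) ((middle t)\<lparr>inst := y\<rparr>) else (middle t)\<lparr>inst := y\<rparr>)"
  using live_add[OF assms]
  by (cases rule: wfast_add.cases) (auto simp: middle_def unit_eq)

lemma time_induct [consumes 2, case_names init live]:
  assumes "W \<le> t" "t \<le> now" and "P W"
    and "\<And>t. W \<le> t \<Longrightarrow> t < now \<Longrightarrow> live (Suc t) \<Longrightarrow> P t \<Longrightarrow> P (Suc t)"
  shows "P t"
  using assms(1,2)
proof (induction t rule: dec_induct)
  case base
  show ?case by (rule assms)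
next
  case (step t)
  then show ?case by (intro assms(4)) (simp_all add: live_def)
qed

section \<open>Change of the FAST estimates along a run\<close>

lemma offset_state: "W \<le> t \<Longrightarrow> t \<le> now \<Longrightarrow> offset (state t) = t mod W"
proof (induction t rule: time_induct)
  case init
  show ?case by (simp add: state_W wfast_init_def)
next
  case (live t)
  from live(3) obtain y where
    "state (Suc t) = (if query y (fst (packet (Suc t))) div T >
        query (inst (middle (Suc t))) (fst (packet (Suc t))) div T
      then push_overflow (fst (packet (Suc t))) ((middle (Suc t))\<lparr>inst := y\<rparr>)
      else (middle (Suc t))\<lparr>inst := y\<rparr>)"
    by (rule state_eq)
  then have "offset (state (Suc t)) = offset (middle (Suc t))" by simp
  then show ?case using live(4) by (simp add: mod_Suc_eq)
qed

lemma inst_middle: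
  assumes "live t"
  shows "inst (middle t) = pre_inst t"
proof -
  obtain u where u: "t = Suc u" "W \<le> u" "u \<le> now"
    using assms by (cases t) (auto simp: live_def)
  then show ?thesis
    using offset_state[of u] by (simp add: pre_inst_def mod_Suc_eq dvd_eq_mod_eq_0)
qed

lemma inst_add_state:
  assumes "live t"
  shows "inst_add M \<epsilon> \<phi> (pre_inst t) (fst (packet t)) (snd (packet t)) (inst (state t))"
    and "state t = (if overflow t then push_overflow (fst (packet t)) ((middle t)\<lparr>inst := inst (state t)\<rparr>)
      else (middle t)\<lparr>inst := inst (state t)\<rparr>)"
proof -
  from assms obtain y where
    y: "inst_add M \<epsilon> \<phi> (inst (middle t)) (fst (packet t)) (snd (packet t)) y"
      "state t = (if query y (fst (packet t)) div T > query (inst (middle t)) (fst (packet t)) div T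
      then push_overflow (fst (packet t)) ((middle t)\<lparr>inst := y\<rparr>) else (middle t)\<lparr>inst := y\<rparr>)"
    by (rule state_eq)
  from y(2) have inst: "inst (state t) = y" by simp
  show "inst_add M \<epsilon> \<phi> (pre_inst t) (fst (packet t)) (snd (packet t)) (inst (state t))"
    using y(1) inst inst_middle[OF assms] by simp
  show "state t = (if overflow t then push_overflow (fst (packet t)) ((middle t)\<lparr>inst := inst (state t)\<rparr>)
      else (middle t)\<lparr>inst := inst (state t)\<rparr>)"
    unfolding inst overflow_def pre_def post_def inst_middle[OF assms, symmetric]
    using y(2) assms by simp
qed

text \<open>The flush precedes the packet of offset 0, so at offset \<open>t mod W\<close> one
  packet more than that has arrived since. In the first frame this is an overcount by one, as time
  \<open>W\<close> has no packet.\<close>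

lemma fast_inv_state:
  "W \<le> t \<Longrightarrow> t \<le> now \<Longrightarrow> fast_inv M (1 / real k) \<phi> (Suc (t mod W)) (inst (state t))"
proof (induction t rule: time_induct)
  case init
  have "fast_inv M (1 / real k) \<phi> (Suc (W mod W)) fast_init"
    by (rule fast_inv_mono[OF fast_inv_init[OF phi]]) simp
  then show ?case by (simp add: state_W wfast_init_def)
next
  case (live t)
  have "snd (packet (Suc t)) \<le> M" using arrived_le[of "fst (packet (Suc t))" "Suc t"] live(3)
    by (simp add: arrived_def)
  moreover have "fast_inv M (1 / real k) \<phi> (Suc t mod W) (pre_inst (Suc t))"
  proof (cases "W dvd Suc t")
    case True
    then show ?thesis using fast_inv_init[OF phi] by (simp add: pre_inst_def)
  next
    case False
    then have "Suc t mod W = Suc (t mod W)" using mod_Suc[of t W] by (auto simp: dvd_eq_mod_eq_0)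
    then show ?thesis using live(4) False by (simp add: pre_inst_def)
  qed
  ultimately show ?case
    using fast_inv_add[OF _ inst_add_state(1)[OF live(3), folded k_def] _ phi] by simp
qed

lemma fast_inv_pre:
  assumes "live t"
  shows "fast_inv M (1 / real k) \<phi> (t mod W) (pre_inst t)"
proof (cases "W dvd t")
  case True
  then show ?thesis using fast_inv_init[OF phi] by (simp add: pre_inst_def)
next
  case False
  obtain u where u: "t = Suc u" "W \<le> u" "u \<le> now"
    using assms by (cases t) (auto simp: live_def)
  then have "t mod W = Suc (u mod W)" using False mod_Suc[of u W] by (auto simp: dvd_eq_mod_eq_0)
  then show ?thesis using fast_inv_state[OF u(2,3)] False u(1) by (simp add: pre_inst_def)
qed

lemma untracked_le:
  assumes "live t" and "\<not> (x \<in> ids (inst (state t)) \<or>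
    card (ids (inst (state t))) < fast_capacity (1 / real k) \<phi>)"
  shows "k * post t x \<le> Suc (t mod W) * M"
proof -
  have "real (post t x) \<le> 1 / real k * real (Suc (t mod W)) * real M"
    unfolding post_def k_def[symmetric]
    by (rule fast_query_untracked_le[OF fast_inv_state _ phi assms(2)])
      (use assms(1) k_pos in \<open>auto simp: live_def\<close>)
  then have "real (k * post t x) \<le> real (Suc (t mod W) * M)"
    using k_pos by (simp add: field_simps)
  then show ?thesis by (simp only: of_nat_le_iff)
qed

text \<open>These are the two alternatives of \<open>step\<close> in \<open>overflow_frame\<close>.
  With accuracy \<open>1 / k\<close>, the bound for untracked ids becomes \<open>T\<close>, and it
  is strict before the last packet of a frame.\<close>

lemma query_step:
  assumes "t \<le> now"
  shows "post t x = pre t x + arrived x t \<and> arrived x t \<le> T \<and>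
      (overflow_of x t \<longleftrightarrow> pre t x div T < post t x div T) \<or>
    \<not> overflow_of x t \<and> arrived x t = 0 \<and> pre t x \<le> post t x \<and> post t x \<le> T \<and>
      (Suc (t mod W) < W \<longrightarrow> post t x < T)"
proof (cases "live t")
  case False
  \<comment> \<open>Here \<open>t \<le> W\<close>: both instances are initial and no packet
    arrives.\<close>
  then have "t - W = 0" "t - 1 - W = 0" using assms by (auto simp: live_def)
  then have "inst (state t) = fast_init" "pre_inst t = fast_init"
    by (auto simp: pre_inst_def state_def S0 wfast_init_def)
  then show ?thesis using False
    by (simp add: pre_def post_def arrived_def overflow_of_def overflow_def)
next
  case live: True
  note add = inst_add_state(1)[OF live]
  have inv: "fast_inv M (1 / real k) \<phi> (t mod W) (pre_inst t)" by (rule fast_inv_pre[OF live])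
  have "M \<le> T" using n_pos by (simp add: T_def)
  with arrived_le[of x t] have le: "arrived x t \<le> T" by (rule order_trans)
  show ?thesis
  proof (cases "fst (packet t) = x")
    case True
    have "finite (ids (pre_inst t))" using inv by (simp add: fast_inv_def)
    then have "post t x = pre t x + arrived x t"
      using fast_query_add_same[OF add] live True by (simp add: post_def pre_def arrived_def)
    then show ?thesis using le True live by (auto simp: overflow_of_def overflow_def)
  next
    case False
    then have none: "arrived x t = 0" "\<not> overflow_of x t"
      by (auto simp: arrived_def overflow_of_def)
    from fast_query_add_other[OF inv[unfolded k_def] add _ phi capacity_pos[unfolded k_def], of x] False
    have "post t x = pre t x \<or> pre t x \<le> post t x \<and> \<not> (x \<in> ids (inst (state t)) \<or>
        card (ids (inst (state t))) < fast_capacity (1 / real k) \<phi>)"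
      by (auto simp: post_def pre_def k_def)
    then show ?thesis
    proof
      assume "post t x = pre t x"
      then show ?thesis using none by simp
    next
      assume *: "pre t x \<le> post t x \<and> \<not> (x \<in> ids (inst (state t)) \<or>
        card (ids (inst (state t))) < fast_capacity (1 / real k) \<phi>)"
      then have "k * post t x \<le> Suc (t mod W) * M" using untracked_le[OF live] by blast
      moreover have kT: "k * T = W * M" by (simp add: T_def W_eq)
      moreover have "Suc (t mod W) * M \<le> W * M" using W by (intro mult_le_mono1) (simp add: Suc_le_eq)
      moreover have "Suc (t mod W) * M < W * M" if "Suc (t mod W) < W"
        by (rule mult_less_mono1[OF that M])
      ultimately have "k * post t x \<le> k * T" "Suc (t mod W) < W \<Longrightarrow> k * post t x < k * T"
        by linarith+
      then show ?thesis using none * k_pos by auto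
    qed
  qed
qed

section \<open>Contents of the queues\<close>

lemma pushed_append: "a \<le> b \<Longrightarrow> b \<le> c \<Longrightarrow> pushed a c = pushed a b @ pushed b c"
proof -
  assume "a \<le> b" "b \<le> c"
  then have "[a..<c] = [a..<b] @ [b..<c]" using upt_add_eq_append[of a b "c - b"] by simp
  then show ?thesis by (simp add: pushed_def)
qed

lemma pushed_Suc:
  "a \<le> t \<Longrightarrow> pushed a (Suc t) = pushed a t @ (if overflow t then [fst (packet t)] else [])"
  by (simp add: pushed_def)

lemma pushed_init: "b \<le> Suc W \<Longrightarrow> pushed a b = []"
  by (auto simp: pushed_def overflow_def live_def filter_empty_conv)

lemma length_pushed: "length (pushed a b) \<le> b - a"
  unfolding pushed_def by (metis length_filter_le length_map length_upt)

lemma count_pushed: "a \<le> b \<Longrightarrow> count_list (pushed a b) x = (\<Sum>t=a..<b. of_bool (overflow_of x t))"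
  by (induction b rule: dec_induct)
    (auto simp: pushed_Suc overflow_of_def sum.atLeastLessThan_Suc simp del: sum_of_bool_eq, simp add: pushed_def)

lemma concat_blocks: "a \<le> b \<Longrightarrow> concat (map block [a..<b]) = pushed (a * n) (b * n)"
proof (induction b rule: dec_induct)
  case base
  show ?case by (simp add: pushed_def)
next
  case (step b)
  then show ?case
    by (simp add: block_def pushed_append[of "a * n" "b * n" "n + b * n"])
qed

text \<open>Inside a block, one more element leaves the oldest queue. At a new block the oldest
  queue is already empty when it is discarded, and the expiry acts on its successor.\<close>

lemma queue_middle:
  assumes live: "live (Suc t)"
    and q: "rev (blocks (state t)) = drop (Suc (t mod n)) (block (t div n - k)) #
      map block [Suc (t div n - k)..<t div n] @ [pushed (t div n * n) (Suc t)]"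
    and tab: "table (state t) = table_of (blocks (state t))"
  defines "u \<equiv> Suc t"
  shows "rev (blocks (middle u)) = drop (Suc (u mod n)) (block (u div n - k)) #
      map block [Suc (u div n - k)..<u div n] @ [pushed (u div n * n) u]"
    and "table (middle u) = table_of (blocks (middle u))"
proof -
  have t: "W \<le> t" "t \<le> now" using live by (auto simp: live_def)
  have "k * n div n \<le> t div n" using t(1) W_eq by (intro div_le_mono) simp
  then have jk: "k \<le> t div n" using n_pos by simp
  define j where "j = t div n"
  define st where "st = start_frame (advance_offset W (state t))"
  define st' where "st' = start_block W \<epsilon> st"
  have st: "blocks st = blocks (state t)" "table st = table (state t)" "offset st = u mod W"
    using offset_state[OF t] by (auto simp: st_def start_frame_def advance_offset_def u_def mod_Suc_eq)
  have mid: "middle u = expire st'" by (simp add: middle_def u_def st'_def st_def)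
  have Wn: "W div wfast_k \<epsilon> = n" using W_eq k_pos by (simp add: k_def[symmetric])
  have mod: "offset st mod n = u mod n" using st(3) by (simp add: W_eq mod_mod_cancel)
  have "\<exists>r rs. rev (blocks st') = r # rs \<and> table st' = table_of (blocks st') \<and>
    tl r # rs = drop (Suc (u mod n)) (block (u div n - k)) #
      map block [Suc (u div n - k)..<u div n] @ [pushed (u div n * n) u]"
  proof (cases "u mod n = 0")
    case True
    then have tm: "Suc (t mod n) = n" unfolding u_def using n_pos by (simp add: mod_Suc split: if_splits)
    then have u_div: "u div n = Suc j" unfolding u_def j_def by (simp add: div_Suc mod_Suc)
    then have u_eq: "u = Suc j * n" using True by (metis add.right_neutral div_mult_mod_eq)
    \<comment> \<open>A block pushes at most one id per packet, so \<open>n\<close> removals have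
      emptied it; discarding the queue then leaves the table correct.\<close>
    have "drop n (block (j - k)) = []"
      using length_pushed[of "(j - k) * n" "Suc (j - k) * n"] by (simp add: block_def)
    then have q': "rev (blocks st) = [] # map block [Suc (j - k)..<j] @ [block j]"
      using q tm u_eq st(1) unfolding j_def[symmetric] block_def u_def by simp
    then have bs: "blocks st = block j # rev (map block [Suc (j - k)..<j]) @ [[]]"
      by (simp add: rev_swap)
    have st': "st' = st\<lparr>blocks := [] # butlast (blocks st)\<rparr>"
      using mod True Wn by (simp add: st'_def start_block_def)
    have kj: "Suc (j - k) \<le> j" "Suc j - k = Suc (j - k)" using jk k_pos by (auto simp: j_def)
    have "rev (blocks st') = map block [Suc (j - k)..<j] @ [block j, []]"
      using bs by (simp add: st' butlast_append)
    also have "\<dots> = map block [Suc (j - k)..<Suc j] @ [[]]" using kj by simp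
    also have "\<dots> = block (Suc (j - k)) # map block [Suc (Suc (j - k))..<Suc j] @ [[]]"
      using kj by (simp add: upt_conv_Cons del: upt_Suc)
    finally have r: "rev (blocks st') = block (Suc (j - k)) # map block [Suc (Suc (j - k))..<Suc j] @ [[]]" .
    moreover have "table_of (blocks st') = table_of (blocks st)"
      by (simp add: st' bs table_of_def fun_eq_iff butlast_append)
    then have "table st' = table_of (blocks st')" using tab st(1,2) by (simp add: st')
    moreover have "pushed (Suc j * n) u = []" using u_eq by (simp add: pushed_def)
    ultimately show ?thesis using True unfolding u_div kj(2) by (auto simp: drop_Suc simp del: upt_Suc)
  next
    case False
    then have "Suc (t mod n) \<noteq> n" unfolding u_def by (auto simp: mod_Suc)
    then have "u mod n = Suc (t mod n)" "u div n = t div n"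
      unfolding u_def by (simp_all add: mod_Suc div_Suc)
    moreover have "st' = st" using mod False Wn by (simp add: st'_def start_block_def)
    ultimately show ?thesis using q tab st(1,2) by (simp add: u_def drop_Suc tl_drop)
  qed
  then obtain r rs where "rev (blocks st') = r # rs" "table st' = table_of (blocks st')"
    "tl r # rs = drop (Suc (u mod n)) (block (u div n - k)) #
      map block [Suc (u div n - k)..<u div n] @ [pushed (u div n * n) u]"
    by blast
  then show "rev (blocks (middle u)) = drop (Suc (u mod n)) (block (u div n - k)) #
      map block [Suc (u div n - k)..<u div n] @ [pushed (u div n * n) u]"
    and "table (middle u) = table_of (blocks (middle u))"
    using expire_rev[of st' r rs] unfolding mid by auto
qed

lemma queue_state:
  assumes "W \<le> t" and "t \<le> now"
  shows "rev (blocks (state t)) = drop (Suc (t mod n)) (block (t div n - k)) #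
      map block [Suc (t div n - k)..<t div n] @ [pushed (t div n * n) (Suc t)] \<and>
    table (state t) = table_of (blocks (state t))"
  using assms
proof (induction t rule: time_induct)
  case init
  have div: "W div n = k" using n_pos W_eq by simp
  \<comment> \<open>Blocks before time \<open>W\<close> hold no packets. Hence it does not matter
    that the block starting at \<open>W\<close> sees one removal fewer than the formula for the
    oldest queue counts.\<close>
  have empty: "block i = []" if "i < k" for i
  proof -
    have "Suc i * n \<le> k * n" using that by (intro mult_le_mono1) simp
    then show ?thesis unfolding block_def using W_eq by (intro pushed_init) simp
  qed
  then have "map block [Suc 0..<k] = map (\<lambda>_. []) [Suc 0..<k]" by (intro map_cong) auto
  also have "\<dots> = replicate (k - 1) []" by (simp add: map_replicate_const)
  finally have "map block [Suc 0..<k] = replicate (k - 1) []" .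
  moreover have "rev (blocks (state W)) = replicate (Suc k) []"
    by (simp add: state_W wfast_init_def k_def[symmetric] replicate_append_same)
  moreover have "replicate (Suc k) [] = [] # replicate (k - 1) [] @ [[]]"
    using k_pos by (cases k) (simp_all add: replicate_append_same)
  moreover have "table (state W) = table_of (blocks (state W))"
    by (auto simp: state_W wfast_init_def table_of_def fun_eq_iff)
  ultimately show ?case using empty[OF k_pos] by (simp add: div pushed_init)
next
  case (live t)
  define u where "u = Suc t"
  define qs where "qs = drop (Suc (u mod n)) (block (u div n - k)) # map block [Suc (u div n - k)..<u div n]"
  have mid: "rev (blocks (middle u)) = qs @ [pushed (u div n * n) u]"
    "table (middle u) = table_of (blocks (middle u))"
    using queue_middle[OF live(3)] live(4) by (simp_all add: qs_def u_def)
  define m where "m = (middle u)\<lparr>inst := inst (state u)\<rparr>"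
  have m: "rev (blocks m) = qs @ [pushed (u div n * n) u]" "table m = table_of (blocks m)"
    using mid by (simp_all add: m_def)
  have state: "state u = (if overflow u then push_overflow (fst (packet u)) m else m)"
    unfolding m_def u_def by (rule inst_add_state(2)[OF live(3)])
  have "u div n * n \<le> u" by (simp add: div_times_less_eq_dividend)
  then have "rev (blocks (state u)) = qs @ [pushed (u div n * n) (Suc u)] \<and>
    table (state u) = table_of (blocks (state u))"
    using push_overflow_rev[OF m, of "fst (packet u)"] m unfolding state by (auto simp: pushed_Suc)
  then show ?case by (simp add: qs_def u_def)
qed

section \<open>The window query against the window volume\<close>

text \<open>Step \<open>i\<close> of the frame starting at \<open>c\<close> is time
  \<open>c + i\<close>. At \<open>i = 0\<close> the estimate is that of the flushed instance, not
  the last one of the previous frame.\<close>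

lemma frame:
  assumes c: "W dvd c" and "c + L \<le> Suc now" and "L \<le> W"
  shows "overflow_frame W L T (\<lambda>i. if i = 0 then 0 else post (c + i - 1) x)
    (\<lambda>i. arrived x (c + i)) (\<lambda>i. overflow_of x (c + i))"
proof
  fix i assume i: "i < L"
  then have "i < W" using assms(3) by simp
  then have mod: "(c + i) mod W = i" using c by (auto elim!: dvdE)
  have "pre (c + i) x = (if i = 0 then 0 else post (c + i - 1) x)"
    using mod c by (auto simp: pre_def pre_inst_def post_def dvd_eq_mod_eq_0)
  moreover have "c + i \<le> now" using i assms(2) by simp
  ultimately show "(if Suc i = 0 then 0 else post (c + Suc i - 1) x) =
       (if i = 0 then 0 else post (c + i - 1) x) + arrived x (c + i) \<and>
       arrived x (c + i) \<le> T \<and>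
       overflow_of x (c + i) = ((if i = 0 then 0 else post (c + i - 1) x) div T <
         (if Suc i = 0 then 0 else post (c + Suc i - 1) x) div T) \<or>
       \<not> overflow_of x (c + i) \<and> arrived x (c + i) = 0 \<and>
       (if i = 0 then 0 else post (c + i - 1) x) \<le> (if Suc i = 0 then 0 else post (c + Suc i - 1) x) \<and>
       (if Suc i = 0 then 0 else post (c + Suc i - 1) x) \<le> T \<and>
       (Suc i < W \<longrightarrow> (if Suc i = 0 then 0 else post (c + Suc i - 1) x) < T)"
    using query_step[of "c + i" x] mod by simp
qed (use T_pos assms in auto)


lemma window_volume_eq:
  "window_volume W p x = (\<Sum>t=Suc (now - W)..<Suc now. arrived x t)"
proof -
  let ?l = "length p - W" and ?g = "arrived x"
  have "window_volume W p x =
      (\<Sum>i\<in>{?l..<length p}. if fst (p ! i) = x then snd (p ! i) else 0)"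
    unfolding window_volume_def by (subst sum.inter_filter[symmetric]) simp_all
  also have "\<dots> = (\<Sum>i=?l..<length p. ?g (i + Suc W))"
    by (rule sum.cong) (auto simp: arrived_def live_def packet_def now_def)
  also have "\<dots> = sum ?g {?l + Suc W..<length p + Suc W}"
    by (rule sum.shift_bounds_nat_ivl[symmetric])
  \<comment> \<open>If the stream is shorter than \<open>W\<close>, the interval also contains times
    up to \<open>W\<close>, at which nothing arrives.\<close>
  also have "\<dots> = sum ?g {Suc (now - W)..<Suc now}"
    by (rule sum.mono_neutral_left) (auto simp: now_def arrived_def live_def)
  finally show ?thesis .
qed

lemma win_query_eq:
  "win_query W M \<epsilon> \<phi> (state now) x =
    (let c = count_list (concat (rev (blocks (state now)))) x; q = post now x in
      int (if c = 0 then 2 * T + q else T * (c + 2) + q mod T))"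
proof -
  have "table (state now) = table_of (blocks (state now))"
    using queue_state[of now] by (simp add: now_def)
  then show ?thesis
    unfolding win_query_def unit_eq post_def by (simp add: table_of_def Let_def distrib_left)
qed

text \<open>The frame boundary \<open>c\<close> splits the window into volumes \<open>vB\<close>
  before and \<open>vA\<close> after it, with overflow counts \<open>cB\<close> and
  \<open>cA\<close>. For the lower bound, the summand \<open>2 * T\<close> pays for one overflow
  missing in \<open>B\<close> and for the rounding in \<open>vB\<close>. For the upper bound, the
  rounding in each of the two frames adds at most \<open>T\<close> to that summand.\<close>

lemma win_query_bounds:
  "int (window_volume W p x) \<le> win_query W M \<epsilon> \<phi> (state now) x"
  "win_query W M \<epsilon> \<phi> (state now) x \<le> int (window_volume W p x + 4 * T)"
proof -
  define j where "j = now mod W"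
  define c where "c = now - j"
  define F where "F = now div W"
  \<comment> \<open>The oldest remembered block \<open>i\<close> starts at time \<open>a\<close>,
    its queue is what \<open>drop m\<close> leaves, and \<open>a + m\<close> is the first time of
    the window.\<close>
  define i where "i = now div n - k"
  define m where "m = Suc (now mod n)"
  define a where "a = i * n"
  define q where "q = post now x"
  define cnt where "cnt u v = (\<Sum>t=u..<v. of_bool (overflow_of x t) :: nat)" for u v
  define vol where "vol u v = (\<Sum>t=u..<v. arrived x t)" for u v
  have W_le: "W \<le> now" by (simp add: now_def)
  have j: "j < W" using W by (simp add: j_def)
  have c_eq: "c = F * W" unfolding c_def j_def F_def by (simp add: minus_mod_eq_div_mult)
  have now_eq: "now = c + j" unfolding c_def j_def by simp
  have "W dvd c" using c_eq by simp
  have "1 \<le> F" using W_le W by (simp add: F_def div_greater_zero_iff Suc_le_eq)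
  then have "W \<le> c" using c_eq by simp
  have "k * n div n \<le> now div n" using W_le W_eq by (intro div_le_mono) simp
  then have k_le: "k \<le> now div n" using n_pos by simp
  have "now = (i + k) * n + now mod n" unfolding i_def using k_le by simp
  then have a_eq: "Suc (now - W) = a + m" by (simp add: a_def m_def W_eq distrib_right)
  have m: "1 \<le> m" "m \<le> n" using n_pos by (simp_all add: m_def Suc_le_eq)
  \<comment> \<open>Both \<open>a\<close> and \<open>c\<close> are multiples of \<open>n\<close>, so
    \<open>a < c\<close> puts the whole oldest block before the current frame.\<close>
  have an: "a + n \<le> c"
  proof -
    have c_eq': "c = F * k * n" unfolding c_eq using W_eq by simp
    have "a < c" using a_eq now_eq j W_le m(1) by linarith
    then have "i < F * k" by (simp add: a_def c_eq')
    then have "Suc i * n \<le> F * k * n" by (intro mult_le_mono1) simp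
    then show ?thesis by (simp add: a_def c_eq')
  qed

  interpret cur: overflow_frame W "Suc j" T "\<lambda>i. if i = 0 then 0 else post (c + i - 1) x"
    "\<lambda>i. arrived x (c + i)" "\<lambda>i. overflow_of x (c + i)"
    by (rule frame) (use \<open>W dvd c\<close> now_eq j in auto)
  interpret prev: overflow_frame W W T "\<lambda>i. if i = 0 then 0 else post (c - W + i - 1) x"
    "\<lambda>i. arrived x (c - W + i)" "\<lambda>i. overflow_of x (c - W + i)"
    by (rule frame) (use \<open>W dvd c\<close> \<open>W \<le> c\<close> now_eq in \<open>auto simp: dvd_diff_nat\<close>)
  have shift: "(\<Sum>t=u..<v. f (b + t)) = sum f {b + u..<b + v}" for f :: "nat \<Rightarrow> nat" and b u v
    using sum.shift_bounds_nat_ivl[of f u b v] by (simp add: add.commute)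
  note shifts = shift[of "arrived x"] shift[of "\<lambda>t. of_bool (overflow_of x t)"]
    vol_def[symmetric] cnt_def[symmetric]
  have start: "c - W + Suc j = Suc (now - W)" using now_eq \<open>W \<le> c\<close> by simp
  have R: "(if Suc j = 0 then 0 else post (c + Suc j - 1) x) = q"
    using now_eq by (simp add: q_def)

  define cA cB vA vB where "cA = cnt c (Suc now)" and "cB = cnt (a + m) c"
    and "vA = vol c (Suc now)" and "vB = vol (a + m) c"
  have A1: "T * cA + q mod T < vA + T"
    using cur.count_upper[of 0 "Suc j"] unfolding shifts R by (simp add: now_eq cA_def vA_def)
  have A2: "vA \<le> T * cA + q mod T \<or> Suc j = W \<and> vA < T * cA + T"
    using cur.vol_upper[of 0 "Suc j"] unfolding shifts R by (simp add: now_eq cA_def vA_def)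
  have A3: "cA = 0 \<Longrightarrow> q \<le> T"
    using cur.le_of_count_eq_0[of "Suc j"] unfolding shifts R by (simp add: now_eq cA_def)
  \<comment> \<open>The remainder at the end of the previous frame was lost in the flush, so it does
    not appear here.\<close>
  have B1: "T * cB < vB + T"
    using prev.count_upper[of "Suc j" W] j \<open>W \<le> c\<close> unfolding shifts start
    by (simp add: a_eq cB_def vB_def)
  have B2: "vB < T * cB + T"
    using prev.vol_less[of "Suc j" W] j \<open>W \<le> c\<close> unfolding shifts start
    by (simp add: a_eq cB_def vB_def)
  \<comment> \<open>As \<open>m \<ge> 1\<close>, fewer than \<open>n\<close> packets remain in the
    oldest block, so their volume is below \<open>T\<close>; two overflows would require more than
    \<open>T\<close>.\<close>
  have tail: "cnt (a + m) (a + n) \<le> 1"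
  proof -
    have le: "Suc j \<le> a + n - (c - W)" "a + n - (c - W) \<le> W" "c - W + (a + n - (c - W)) = a + n"
      using an \<open>W \<le> c\<close> m(2) start a_eq by auto
    have "T * cnt (a + m) (a + n) < vol (a + m) (a + n) + T"
      using prev.count_upper[OF le(1,2)] unfolding shifts start le(3) a_eq by simp
    moreover have "vol (a + m) (a + n) \<le> (n - m) * M"
      unfolding vol_def using sum_bounded_above[of "{a + m..<a + n}" "arrived x" M] arrived_le by simp
    moreover have "(n - m) * M < T"
      using m M n_pos by (simp add: T_def mult.commute)
    ultimately have "T * cnt (a + m) (a + n) < T * 2" by linarith
    then show ?thesis by simp
  qed

  define B where "B = count_list (concat (rev (blocks (state now)))) x"
  have "concat (rev (blocks (state now))) =
      drop m (pushed a (a + n)) @ pushed (a + n) (Suc now)"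
  proof -
    have le: "Suc i \<le> now div n" using k_le k_pos by (simp add: i_def)
    have "concat (map block [Suc i..<now div n]) @ pushed (now div n * n) (Suc now)
        = pushed (Suc i * n) (Suc now)"
      unfolding concat_blocks[OF le]
      by (rule pushed_append[symmetric], rule mult_le_mono1[OF le]) (simp add: le_SucI)
    moreover have "Suc i * n = a + n" by (simp add: a_def)
    ultimately show ?thesis
      using queue_state[OF W_le]
      by (simp add: i_def[symmetric] m_def[symmetric] block_def a_def[symmetric] add.commute[of n a])
  qed
  then have B_eq: "B = count_list (drop m (pushed a (a + n))) x + cnt (a + n) (Suc now)"
    using count_pushed[of "a + n" "Suc now" x] an now_eq by (simp add: B_def cnt_def)
  have "count_list (drop m (pushed a (a + n))) x \<le> count_list (pushed (a + m) (a + n)) x"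
    using count_list_drop_append[of "pushed a (a + m)" m "pushed (a + m) (a + n)" x]
      length_pushed[of a "a + m"] m(2) by (simp add: pushed_append[of a "a + m" "a + n"])
  then have drop: "count_list (drop m (pushed a (a + n))) x \<le> cnt (a + m) (a + n)"
    using count_pushed[of "a + m" "a + n" x] m(2) by (simp add: cnt_def)
  have split: "cnt u v + cnt v w = cnt u w" "vol u v + vol v w = vol u w"
    if "u \<le> v" "v \<le> w" for u v w
    using that by (simp_all only: cnt_def vol_def sum.atLeastLessThan_concat)
  have "cnt (a + m) (a + n) + cnt (a + n) c = cB"
    unfolding cB_def using m an by (intro split) auto
  moreover have "cnt (a + n) c + cA = cnt (a + n) (Suc now)"
    unfolding cA_def using an now_eq by (intro split) auto
  \<comment> \<open>The counts can differ only by the at most one overflow of \<open>x\<close> in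
    the rest of the oldest block, which may have been popped too early.\<close>
  ultimately have B: "B \<le> cA + cB" "cA + cB \<le> B + 1" "cA \<le> B"
    using B_eq drop tail by auto
  have "window_volume W p x = vol (a + m) (Suc now)"
    unfolding window_volume_eq a_eq vol_def ..
  also have "\<dots> = vB + vA"
    unfolding vA_def vB_def by (rule split(2)[symmetric]) (use m an now_eq in auto)
  finally have v: "window_volume W p x = vA + vB" by simp
  \<comment> \<open>At the last time of a frame the window is the current frame alone. So when
    \<open>A2\<close> takes its exceptional alternative, the \<open>T\<close> reserved for rounding
    in \<open>vB\<close> is free.\<close>
  have vB0: "vB = 0" if "Suc j = W" using that start \<open>W \<le> c\<close> a_eq by (simp add: vB_def vol_def)

  have "T * (cA + cB) \<le> T * (B + 1)" "T * B \<le> T * (cA + cB)" "T * cA \<le> T * B"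
    using B by (intro mult_le_mono2; simp)+
  then have TB: "T * cA + T * cB \<le> T * B + T" "T * B \<le> T * cA + T * cB" "T * cA \<le> T * B"
    by (simp_all add: distrib_left)
  have lower: "vA + vB \<le> T * (B + 2) + q mod T"
    using A2 B2 vB0 TB(1,3) by (auto simp: distrib_left)
  have upper: "T * (B + 2) + q mod T \<le> vA + vB + 4 * T"
    using A1 B1 TB(2) by (simp add: distrib_left)
  \<comment> \<open>Without a table entry the query adds \<open>q\<close> instead of
    \<open>q mod T\<close>. No overflow in the current frame means \<open>q \<le> T\<close>, so the
    result is at most \<open>3 * T\<close>.\<close>
  have "vA + vB \<le> 2 * T + q \<and> 2 * T + q \<le> vA + vB + 4 * T" if "B = 0"
  proof -
    have "q \<le> T" "vA + vB \<le> T * 2 + q mod T" using A3 B(3) lower that by simp_all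
    then show ?thesis using mod_less_eq_dividend[of q T] by linarith
  qed
  with lower upper have "vA + vB \<le> (if B = 0 then 2 * T + q else T * (B + 2) + q mod T)"
    "(if B = 0 then 2 * T + q else T * (B + 2) + q mod T) \<le> vA + vB + 4 * T"
    by (simp_all split: if_split)
  then show "int (window_volume W p x) \<le> win_query W M \<epsilon> \<phi> (state now) x"
    "win_query W M \<epsilon> \<phi> (state now) x \<le> int (window_volume W p x + 4 * T)"
    unfolding win_query_eq Let_def q_def[symmetric] B_def[symmetric] v of_nat_le_iff .
qed

end

theorem theorem5:
  fixes U :: "'a set" and W M :: nat and \<epsilon> \<phi> \<theta> :: real
    and p :: "'a stream" and st :: "'a wfast"
  assumes "M > 0" and "W > 0" and "\<epsilon> > 0" and "\<phi> \<ge> 0"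
    and "wfast_k \<epsilon> dvd W"
    and "weighted_stream U M p"
    and "wfast_run W M \<epsilon> \<phi> p st"
  shows "weighted_heavy_hitters U W \<theta> \<epsilon> M p (reported U W M \<epsilon> \<phi> \<theta> st)"
proof -
  obtain S where S: "S 0 = wfast_init \<epsilon>" "S (length p) = st"
    "\<And>i. i < length p \<Longrightarrow> wfast_add W M \<epsilon> \<phi> (S i) (fst (p ! i)) (snd (p ! i)) (S (Suc i))"
    using wfast_run_states[OF assms(7)] by blast
  have "snd (p ! i) \<le> M" if "i < length p" for i
    using assms(6) nth_mem[OF that] by (auto simp: weighted_stream_def)
  then interpret wfast_execution W M "wfast_k \<epsilon>" "W div wfast_k \<epsilon>" \<epsilon> \<phi> p S
    using assms S by unfold_locales auto
  have st: "state now = st" using S(2) by (simp add: state_def now_def)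
  have "real W * real M * \<theta> \<le> real_of_int (win_query W M \<epsilon> \<phi> st x)"
    if "real W * real M * \<theta> < real (window_volume W p x)" for x
    using that win_query_bounds(1)[of x] unfolding st by linarith
  moreover have "real_of_int (win_query W M \<epsilon> \<phi> st x) < real W * real M * \<theta>"
    if "real (window_volume W p x) < real W * real M * (\<theta> - \<epsilon>)" for x
  proof -
    have "real_of_int (win_query W M \<epsilon> \<phi> st x) \<le> real (window_volume W p x) + 4 * real T"
      using win_query_bounds(2)[of x] unfolding st by linarith
    then show ?thesis using that four_T_le by (simp add: right_diff_distrib)
  qed
  ultimately show ?thesis
    by (auto simp: weighted_heavy_hitters_def reported_def mult.commute[of "real M"] not_le)
qed

end
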